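(* Let $N\ge 3$ and $1\le r\le N$, and write $N=qr+s$ with integers $q,s$ and $0\le s<r$. Consider all sets $R$ consisting of $r$ rim vertices of the wheel graph $W_{N+1}$ with central vertex $c$, and let $d_1,\ldots,d_r$ denote the cyclic intervals of $R$. (1) Among all such $R$, the number $\mathcal F_{W_{N+1}}(\{c\}\cup R)$ is maximized if and only if, in the cyclic interval sequence $(d_1,\ldots,d_r)$, the value $q+1$ appears $s$ times and the value $q$ appears $r-s$ times. The maximum value is $$F_{2(q+1)}^{\,s}F_{2q}^{\,r-s}.$$ (2) Among all such $R$, the number $\mathcal F_{W_{N+1}}(\{c\}\cup R)$ is minimized if and only if $(d_1,\ldots,d_r)$ is a permutation of $(N-r+1,1,\ldots,1)$ (with $r-1$ entries equal to $1$ after the first). The minimum value is $$F_{2(N-r+1)}.$$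
   Context: The wheel graph $W_{N+1}$ ($N\ge3$) has vertex set $\{c,v_1,\ldots,v_N\}$ and edges $\{v_i,v_{i+1}\}$ (indices modulo $N$) and $\{c,v_i\}$ for $1\le i\le N$; $c$ is the central vertex and the $v_i$ are the rim vertices. For a set $R=\{v_{a_1},\ldots,v_{a_r}\}$ of rim vertices with $1\le a_1<\cdots<a_r\le N$, the cyclic intervals are $d_i=a_{i+1}-a_i$ for $1\le i\le r-1$ and $d_r=a_1+N-a_r$. For a finite connected graph $G$ and $\varnothing\ne S\subseteq V(G)$, a rooted spanning forest of $G$ with root set $S$ is a spanning forest (an acyclic subgraph containing all vertices of $G$) in which each connected component contains exactly one vertex of $S$; $\mathcal F_G(S)$ denotes the number of such forests. Fibonacci numbers: $F_0=0$, $F_1=1$, $F_{n+2}=F_{n+1}+F_n$. *)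

theory Defs
  imports
    "Graph_Theory.Graph_Theory"
    "HOL-Library.Multiset"
    "HOL-Number_Theory.Fib"
begin

text \<open>
  An undirected graph is represented as a symmetric digraph (\<^locale>\<open>pair_graph\<close>): an edge
  \<open>{u, v}\<close> is the pair of arcs \<open>(u, v)\<close> and \<open>(v, u)\<close>.
\<close>

datatype wheel_vertex = Center | Rim nat

definition rim :: "nat \<Rightarrow> wheel_vertex set" where
  "rim N = Rim ` {1..N}"

definition wheel_arcs :: "nat \<Rightarrow> wheel_vertex rel" where
  "wheel_arcs N =
     {(Rim i, Rim (i mod N + 1)) | i. i \<in> {1..N}} \<union> {(Center, Rim i) | i. i \<in> {1..N}}"

text \<open>\<open>wheel N\<close> is $W_{N+1}$; for \<open>1 \<le> i \<le> N\<close>, the rim successor of \<open>i\<close> is \<open>i mod N + 1\<close>.\<close>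

definition wheel :: "nat \<Rightarrow> wheel_vertex pair_pre_digraph" where
  "wheel N = \<lparr> pverts = insert Center (rim N), parcs = wheel_arcs N \<union> (wheel_arcs N)\<inverse> \<rparr>"

lemma pair_graph_wheel:
  assumes "3 \<le> N"
  shows "pair_graph (wheel N)"
proof -
  have fin: "finite (wheel_arcs N)"
    by (auto simp: wheel_arcs_def setcompr_eq_image)
  have mem: "Suc (i mod N) \<le> N" for i
    using assms by (intro Suc_leI mod_less_divisor) simp
  have neq: "i \<noteq> Suc (i mod N)" for i
  proof (cases i N rule: linorder_cases)
    case greater
    then show ?thesis using mem[of i] by simp
  qed (use assms in auto)
  show ?thesis
  proof
    fix e assume "e \<in> parcs (wheel N)"
    then show "fst e \<in> pverts (wheel N)" "snd e \<in> pverts (wheel N)" "fst e \<noteq> snd e"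
      using mem neq neq[symmetric] by (auto simp: wheel_def wheel_arcs_def rim_def)
  next
    show "finite (pverts (wheel N))" "finite (parcs (wheel N))"
      using fin by (auto simp: wheel_def rim_def)
  next
    show "symmetric (wheel N)"
      by (auto simp: wheel_def symmetric_def sym_Un_converse)
  qed
qed

text \<open>
  The library predicate \<^const>\<open>forest\<close> is unsuitable for symmetric digraphs: traversing an edge back
  and forth is already a \<^const>\<open>pre_digraph.cycle\<close> of length 2. In a symmetric digraph without loops
  and parallel arcs, the cycles of the underlying undirected graph are those of length at least 3.
\<close>

definition undirected_acyclic :: "('a, 'b) pre_digraph \<Rightarrow> bool" where
  "undirected_acyclic G \<longleftrightarrow> \<not> (\<exists>p. pre_digraph.cycle G p \<and> 3 \<le> length p)"

text \<open>
  The connected components of a symmetric digraph are its strongly connected components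
  \<^const>\<open>pre_digraph.sccs\<close>.
\<close>

definition rooted_spanning_forest ::
    "'a pair_pre_digraph \<Rightarrow> 'a set \<Rightarrow> 'a pair_pre_digraph \<Rightarrow> bool" where
  "rooted_spanning_forest G S H \<longleftrightarrow>
     spanning (with_proj H) (with_proj G) \<and> symmetric (with_proj H) \<and>
     undirected_acyclic (with_proj H) \<and>
     (\<forall>C \<in> pre_digraph.sccs (with_proj H). \<exists>!v. v \<in> verts C \<and> v \<in> S)"

definition num_rooted_spanning_forests :: "'a pair_pre_digraph \<Rightarrow> 'a set \<Rightarrow> nat" where
  "num_rooted_spanning_forests G S = card {H. rooted_spanning_forest G S H}"

definition rim_subsets :: "nat \<Rightarrow> nat \<Rightarrow> wheel_vertex set set" where
  "rim_subsets N r = {R. R \<subseteq> rim N \<and> card R = r}"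

text \<open>Intended for nonempty \<open>R \<subseteq> rim N\<close>.\<close>

definition cyclic_intervals :: "nat \<Rightarrow> wheel_vertex set \<Rightarrow> nat list" where
  "cyclic_intervals N R =
     (let a = sorted_list_of_set {i. Rim i \<in> R}; r = length a
      in map (\<lambda>i. a ! (i + 1) - a ! i) [0..<r - 1] @ [hd a + N - last a])"

end

theory Submission
  imports Defs Complex_Main "HOL-Number_Theory.Cong"
begin

text \<open>
  Orienting every tree towards its root turns a rooted spanning forest into an acyclic parent
  function. In the wheel, with the center and at least one rim vertex being roots, a rim vertex has
  as parent the center or one of its two rim neighbours, and the only possible obstruction to
  acyclicity is that two adjacent rim vertices are parents of each other. Forests are therefore
  words over a three-letter alphabet on the stretches between consecutive roots that avoid one
  two-letter factor; on a stretch belonging to a cyclic interval \<open>d\<close> there are $F_{2d}$ of them.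
  It remains to optimise $\prod F_{2d_i}$ over compositions of \<open>N\<close>. The maximum follows by
  comparing the strictly concave sequence $\ln F_{2d}$ with its secant through \<open>q\<close> and \<open>q + 1\<close>;
  the minimum follows from $F_{2a+2} F_{2b+2} = F_{2(a+b)+2} + F_{2a} F_{2b}$.
\<close>

section \<open>Rooted forests and parent functions\<close>

text \<open>
  A forest is encoded by the map sending each non-root to its neighbour on the path to the root; such
  a map is a forest exactly if it has no cycles, which is expressed by a rank decreasing along it.
\<close>

definition parent_functions :: "'a pair_pre_digraph \<Rightarrow> 'a set \<Rightarrow> ('a \<Rightarrow> 'a) set" where
  "parent_functions G S =
     {p \<in> extensional (pverts G - S).
        (\<forall>v \<in> pverts G - S. (v, p v) \<in> parcs G) \<and>
        (\<exists>rk :: 'a \<Rightarrow> nat. \<forall>v \<in> pverts G - S. rk (p v) < rk v)}"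

definition parent_forest :: "'a pair_pre_digraph \<Rightarrow> 'a set \<Rightarrow> ('a \<Rightarrow> 'a) \<Rightarrow> 'a pair_pre_digraph" where
  "parent_forest G S p =
     \<lparr> pverts = pverts G,
       parcs = {(v, p v) | v. v \<in> pverts G - S} \<union> {(p v, v) | v. v \<in> pverts G - S} \<rparr>"

lemma pverts_parent_forest [simp]: "pverts (parent_forest G S p) = pverts G"
  by (simp add: parent_forest_def)

lemma parcs_parent_forest:
  "(x, y) \<in> parcs (parent_forest G S p) \<longleftrightarrow>
     x \<in> pverts G - S \<and> y = p x \<or> y \<in> pverts G - S \<and> x = p y"
  by (auto simp: parent_forest_def)

section \<open>Cycles in the forest of a parent function\<close>

lemma pcas_nth:
  assumes "pcas u q v"
  shows "Suc i < length q \<Longrightarrow> fst (q ! Suc i) = snd (q ! i)"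
    and "q \<noteq> [] \<Longrightarrow> fst (hd q) = u" and "q \<noteq> [] \<Longrightarrow> snd (last q) = v"
proof -
  show "q \<noteq> [] \<Longrightarrow> fst (hd q) = u"
    using assms by (cases q) auto
  show "q \<noteq> [] \<Longrightarrow> snd (last q) = v"
    using assms by (induction q arbitrary: u) auto
  show "Suc i < length q \<Longrightarrow> fst (q ! Suc i) = snd (q ! i)"
    using assms
  proof (induction q arbitrary: u i)
    case (Cons e es)
    then show ?case
      by (cases i; cases es) auto
  qed simp
qed

text \<open>Extending the vertex sequence of a cycle periodically to all naturals makes the closing
  arc look like every other arc, and lets the predecessor of index \<open>m\<close> be written as
  index \<open>m + (length q - 1)\<close>.\<close>

lemma cycle_periodic_vertices:
  assumes "pair_wf_digraph H" and "pre_digraph.cycle (with_proj H) q"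
  obtains y where "\<And>i. (y i, y (Suc i)) \<in> parcs H"
    and "\<And>i j. y i = y j \<longleftrightarrow> i mod length q = j mod length q"
proof -
  interpret pair_wf_digraph H by fact
  obtain u where walk: "awalk u q u" and dist: "distinct (tl (pawalk_verts u q))" and ne: "q \<noteq> []"
    using assms(2) unfolding cycle_def by auto
  define n where "n = length q"
  have n: "0 < n" using ne by (simp add: n_def)
  have cas: "pcas u q u" and arcs: "set q \<subseteq> parcs H"
    using walk by (auto simp: awalk_def)
  \<comment> \<open>The vertex list of the walk is \<open>u\<close> followed by the heads of its
    arcs, so its distinct tail is the list of heads.\<close>
  have dist': "distinct (map snd q)"
    using dist awalk_verts_conv'[OF cas] ne by simp
  define y where "y i = snd (q ! (i mod n))" for i
  have step: "fst (q ! (Suc i mod n)) = y i" for i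
  proof (cases "Suc (i mod n) = n")
    case True
    then have "Suc i mod n = 0" by (simp add: mod_Suc)
    moreover have "q ! (i mod n) = last q"
      using True ne by (metis diff_Suc_1 last_conv_nth n_def)
    ultimately show ?thesis
      using pcas_nth(2,3)[OF cas ne] ne by (simp add: y_def hd_conv_nth)
  next
    case False
    then have "Suc i mod n = Suc (i mod n)" by (simp add: mod_Suc)
    moreover have "Suc (i mod n) < length q"
      using False n by (metis Suc_lessI mod_less_divisor n_def)
    ultimately show ?thesis
      using pcas_nth(1)[OF cas] by (simp add: y_def)
  qed
  show thesis
  proof
    fix i
    have "q ! (Suc i mod n) \<in> set q"
      using n by (simp add: n_def)
    moreover have "q ! (Suc i mod n) = (y i, y (Suc i))"
      using step[of i] by (simp add: y_def prod_eq_iff)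
    ultimately show "(y i, y (Suc i)) \<in> parcs H"
      using arcs by auto
  next
    fix i j
    show "y i = y j \<longleftrightarrow> i mod length q = j mod length q"
      using nth_eq_iff_index_eq[OF dist', of "i mod n" "j mod n"] n
      by (simp add: y_def n_def)
  qed
qed

text \<open>A vertex of maximal rank on a cycle would have its parent as both neighbours.\<close>

lemma undirected_acyclic_parent_forest:
  fixes rk :: "'a \<Rightarrow> nat"
  assumes "pair_wf_digraph (parent_forest G S p)"
    and "\<And>v. v \<in> pverts G - S \<Longrightarrow> rk (p v) < rk v"
  shows "undirected_acyclic (with_proj (parent_forest G S p))"
  unfolding undirected_acyclic_def
proof (intro notI, elim exE conjE)
  fix q assume cyc: "pre_digraph.cycle (with_proj (parent_forest G S p)) q" and len: "3 \<le> length q"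
  define n where "n = length q"
  obtain y where y: "\<And>i. (y i, y (Suc i)) \<in> parcs (parent_forest G S p)"
    and inj: "\<And>i j. y i = y j \<longleftrightarrow> i mod n = j mod n"
    using cycle_periodic_vertices[OF assms(1) cyc] unfolding n_def by blast
  have n: "0 < n" using len unfolding n_def by linarith
  have "finite ((rk \<circ> y) ` {..<n})" "(rk \<circ> y) ` {..<n} \<noteq> {}"
    using n by (auto simp: lessThan_empty_iff)
  from Max_in[OF this] obtain m where m: "rk (y m) = Max ((rk \<circ> y) ` {..<n})"
    by auto
  have max: "rk (y i) \<le> rk (y m)" for i
  proof -
    have "y i = y (i mod n)" by (simp add: inj)
    moreover have "i mod n < n" using n by simp
    ultimately show ?thesis by (auto simp: m intro!: Max_ge)
  qed
  \<comment> \<open>An edge joins a vertex to its parent, and a \<open>z\<close> with parent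
    \<open>y m\<close> would have larger rank.\<close>
  have parent: "z = p (y m)" if "z \<in> range y"
      "(y m, z) \<in> parcs (parent_forest G S p) \<or> (z, y m) \<in> parcs (parent_forest G S p)" for z
  proof -
    have "z = p (y m) \<or> z \<in> pverts G - S \<and> y m = p z"
      using that(2) by (auto simp: parcs_parent_forest)
    moreover have "rk z \<le> rk (y m)"
      using that(1) max by blast
    ultimately show ?thesis
      using assms(2)[of z] by auto
  qed
  have shift: "y (Suc (m + (n - 1))) = y m"
  proof -
    have "Suc (m + (n - 1)) = m + n" using n by simp
    then show ?thesis by (simp add: inj)
  qed
  have "(y (m + (n - 1)), y m) \<in> parcs (parent_forest G S p)"
    using y[of "m + (n - 1)"] by (simp only: shift)
  then have "y (m + (n - 1)) = y (Suc m)"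
    using parent[of "y (m + (n - 1))"] parent[of "y (Suc m)"] y[of m] by simp
  then have "(m + (n - 1)) mod n = Suc m mod n"
    by (simp add: inj)
  \<comment> \<open>Adding 1 turns the predecessor index into \<open>m + n\<close>, so the
    coincidence of predecessor and successor becomes \<open>0 = 2\<close> modulo \<open>n\<close>,
    which \<open>3 \<le> length q\<close> excludes.\<close>
  then have "(m + (n - 1) + 1) mod n = (Suc m + 1) mod n"
    by (metis mod_add_left_eq)
  moreover have "m + (n - 1) + 1 = m + n" using n by simp
  ultimately have "m mod n = (m + 2) mod n"
    by simp
  then have "[m + 0 = m + 2] (mod n)"
    by (simp add: cong_def)
  then have "[0 = 2] (mod n)"
    by (simp only: cong_add_lcancel_nat)
  then show False
    using len by (simp add: cong_def n_def)
qed

text \<open>In a symmetric digraph the strong component of \<open>u\<close> consists of everything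
  reachable from \<open>u\<close>, so the condition on components can be tested vertex by
  vertex.\<close>

lemma Ball_sccs_conv_reachable:
  assumes "pair_sym_digraph H"
  shows "(\<forall>C \<in> pre_digraph.sccs (with_proj H). \<exists>!v. v \<in> verts C \<and> v \<in> S) \<longleftrightarrow>
         (\<forall>u \<in> pverts H. \<exists>!v. u \<rightarrow>\<^sup>*\<^bsub>with_proj H\<^esub> v \<and> v \<in> S)"
proof -
  interpret pair_sym_digraph H by fact
  have "verts ` sccs = scc_of ` pverts H"
    using sccs_verts_conv sccs_verts_conv_scc_of by simp
  moreover have "v \<in> scc_of u \<longleftrightarrow> u \<rightarrow>\<^sup>*\<^bsub>with_proj H\<^esub> v" for u v
    using symmetric_reachable' by (auto simp: scc_of_def)
  moreover have "(\<forall>C \<in> sccs. \<exists>!v. v \<in> verts C \<and> v \<in> S) \<longleftrightarrow>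
      (\<forall>A \<in> verts ` sccs. \<exists>!v. v \<in> A \<and> v \<in> S)"
    by blast
  ultimately show ?thesis
    by simp
qed

lemma pair_sym_digraph_parent_forest:
  assumes "pair_wf_digraph G" and "\<And>v. v \<in> pverts G - S \<Longrightarrow> (v, p v) \<in> parcs G"
  shows "pair_sym_digraph (parent_forest G S p)"
proof -
  interpret G: pair_wf_digraph G by fact
  show ?thesis
  proof
    fix e assume "e \<in> parcs (parent_forest G S p)"
    then show "fst e \<in> pverts (parent_forest G S p)" "snd e \<in> pverts (parent_forest G S p)"
      using assms(2) G.wellformed' by (cases e; fastforce simp: parcs_parent_forest)+
  next
    show "symmetric (with_proj (parent_forest G S p))"
      by (auto simp: symmetric_def sym_def parcs_parent_forest)
  qed
qed

text \<open>Existence: climbing along \<open>p\<close> lowers the rank until a root is met.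
  Uniqueness: the root met in this way is the same at both ends of every arc, hence constant under
  reachability, and a root meets itself.\<close>

lemma parent_forest_reaches_unique_root:
  fixes rk :: "'a \<Rightarrow> nat"
  assumes "pair_wf_digraph (parent_forest G S p)"
    and "\<And>v. v \<in> pverts G - S \<Longrightarrow> rk (p v) < rk v"
    and "u \<in> pverts G"
  shows "\<exists>!v. u \<rightarrow>\<^sup>*\<^bsub>with_proj (parent_forest G S p)\<^esub> v \<and> v \<in> S"
proof -
  interpret pair_wf_digraph "parent_forest G S p" by fact
  let ?H = "with_proj (parent_forest G S p)"
  have ex: "\<exists>n. (p ^^ n) v \<in> S \<and> v \<rightarrow>\<^sup>*\<^bsub>?H\<^esub> (p ^^ n) v" if "v \<in> pverts G" for v
    using that
  proof (induction "rk v" arbitrary: v rule: less_induct)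
    case less
    show ?case
    proof (cases "v \<in> S")
      case True
      then show ?thesis using less.prems by (intro exI[of _ 0]) auto
    next
      case False
      have arc: "(v, p v) \<in> parcs (parent_forest G S p)"
        using False less.prems by (simp add: parcs_parent_forest)
      then have "p v \<in> pverts G"
        using in_arcsD2 by fastforce
      with less.hyps[of "p v"] False less.prems assms(2) obtain n
        where "(p ^^ n) (p v) \<in> S" "p v \<rightarrow>\<^sup>*\<^bsub>?H\<^esub> (p ^^ n) (p v)"
        by auto
      then show ?thesis
        using adj_reachable_trans[OF arc] by (intro exI[of _ "Suc n"]) (simp add: funpow_swap1)
    qed
  qed
  \<comment> \<open>Taking the first root on the orbit matters because \<open>p\<close> is arbitrary
    on \<open>S\<close>; it gives \<open>root v = v\<close> for roots.\<close>
  define root where "root v = (p ^^ (LEAST n. (p ^^ n) v \<in> S)) v" for v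
  have root_S: "root v = v" if "v \<in> S" for v
  proof -
    have "(LEAST n. (p ^^ n) v \<in> S) = 0"
      using that by (intro Least_equality) auto
    then show ?thesis by (simp add: root_def)
  qed
  have root_p: "root (p v) = root v" if "v \<in> pverts G - S" for v
  proof -
    have v: "v \<in> pverts G" "v \<notin> S" using that by auto
    obtain n where "(p ^^ n) v \<in> S" using ex[OF v(1)] by blast
    then have "(LEAST n. (p ^^ n) v \<in> S) = Suc (LEAST m. (p ^^ Suc m) v \<in> S)"
      using v by (intro Least_Suc[where n = n]) auto
    then show ?thesis by (simp add: root_def funpow_swap1)
  qed
  have inv: "root a = root b" if "a \<rightarrow>\<^sup>*\<^bsub>?H\<^esub> b" for a b
    using that
  proof (induction rule: reachable_induct)
    case (step x y)
    then have "root x = root y"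
      using root_p by (auto simp: parcs_parent_forest)
    with step show ?case by simp
  qed simp
  obtain n where "(p ^^ n) u \<in> S" "u \<rightarrow>\<^sup>*\<^bsub>?H\<^esub> (p ^^ n) u"
    using ex assms(3) by blast
  then show ?thesis
    using inv root_S by metis
qed

lemma rooted_spanning_forest_parent_forest:
  assumes "pair_wf_digraph G" and p: "p \<in> parent_functions G S" and "sym (parcs G)"
  shows "rooted_spanning_forest G S (parent_forest G S p)"
proof -
  obtain rk :: "'a \<Rightarrow> nat" where rk: "\<And>v. v \<in> pverts G - S \<Longrightarrow> rk (p v) < rk v"
    and arc: "\<And>v. v \<in> pverts G - S \<Longrightarrow> (v, p v) \<in> parcs G"
    using p unfolding parent_functions_def by auto
  interpret G: pair_wf_digraph G by fact
  interpret H: pair_sym_digraph "parent_forest G S p"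
    using pair_sym_digraph_parent_forest[OF assms(1) arc] by blast
  have "(p v, v) \<in> parcs G" if "v \<in> pverts G - S" for v
    using arc[OF that] \<open>sym (parcs G)\<close> by (blast dest: symD)
  then have "spanning (with_proj (parent_forest G S p)) (with_proj G)"
    using arc G.wf_digraph H.wf_digraph
    by (auto simp: spanning_def subgraph_def compatible_def parcs_parent_forest)
  then show ?thesis
    using undirected_acyclic_parent_forest[where rk = rk, OF H.pair_wf_digraph_axioms rk]
      parent_forest_reaches_unique_root[where rk = rk, OF H.pair_wf_digraph_axioms rk]
      Ball_sccs_conv_reachable[OF H.pair_sym_digraph_axioms] H.pair_sym_arcs
    by (auto simp: rooted_spanning_forest_def)
qed

text \<open>At a disagreement of minimal rank the parent is again a disagreement.\<close>

lemma inj_on_parent_forest: "inj_on (parent_forest G S) (parent_functions G S)"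
proof (rule inj_onI)
  fix p p' assume p: "p \<in> parent_functions G S" and p': "p' \<in> parent_functions G S"
    and eq: "parent_forest G S p = parent_forest G S p'"
  obtain rk :: "'a \<Rightarrow> nat" where rk: "\<And>v. v \<in> pverts G - S \<Longrightarrow> rk (p v) < rk v"
    using p unfolding parent_functions_def by auto
  have "p v = p' v" if "v \<in> pverts G - S" for v
    using that
  proof (induction "rk v" arbitrary: v rule: less_induct)
    case less
    show ?case
    proof (rule ccontr)
      assume ne: "p v \<noteq> p' v"
      have "(v, p v) \<in> parcs (parent_forest G S p')"
        using less.prems by (simp add: eq[symmetric] parcs_parent_forest)
      then have pv: "p v \<in> pverts G - S" "p' (p v) = v"
        using ne by (auto simp: parcs_parent_forest)
      then have "p (p v) = v"
        using less.hyps[of "p v"] rk[OF less.prems] by simp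
      then show False
        using rk[OF less.prems] rk[OF pv(1)] by simp
    qed
  qed
  then show "p = p'"
    using p p' unfolding parent_functions_def by (auto intro: extensionalityI)
qed

text \<open>Sending each non-root to a neighbour one step closer to \<open>S\<close> gives a parent
  function whose forest lies inside \<open>H\<close>. An additional edge of \<open>H\<close> would
  close a cycle, since its ends are already joined in that forest.\<close>

lemma rooted_spanning_forest_imp_parent_forest:
  assumes "pair_loopfree_digraph G" and H: "rooted_spanning_forest G S H"
  obtains p where "p \<in> parent_functions G S" and "H = parent_forest G S p"
proof -
  interpret G: pair_loopfree_digraph G by fact
  have verts: "pverts H = pverts G" and sub: "parcs H \<subseteq> parcs G" and wf: "wf_digraph (with_proj H)"
    and sym: "symmetric (with_proj H)" and acyc: "undirected_acyclic (with_proj H)"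
    using H by (auto simp: rooted_spanning_forest_def spanning_def subgraph_def)
  interpret H: pair_sym_digraph H
    using wf_digraph.tail_in_verts[OF wf] wf_digraph.head_in_verts[OF wf] sym
    by unfold_locales auto
  have symH: "(y, x) \<in> parcs H" if "(x, y) \<in> parcs H" for x y
    using sym that by (auto simp: symmetric_def sym_def)
  have root: "\<exists>!v. u \<rightarrow>\<^sup>*\<^bsub>with_proj H\<^esub> v \<and> v \<in> S" if "u \<in> pverts G" for u
    using H that verts Ball_sccs_conv_reachable[OF H.pair_sym_digraph_axioms]
    by (auto simp: rooted_spanning_forest_def)
  \<comment> \<open>\<open>rk v\<close> will be the distance from \<open>v\<close> to the nearest
    root, measured by powers of the arc relation.\<close>
  define near where "near v n \<longleftrightarrow> (\<exists>w \<in> S. (v, w) \<in> parcs H ^^ n)" for v n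
  define rk where "rk v = (LEAST n. near v n)" for v
  have near_ex: "\<exists>n. near v n" if v: "v \<in> pverts G" for v
  proof -
    obtain w where w: "w \<in> S" "v \<rightarrow>\<^sup>*\<^bsub>with_proj H\<^esub> w" using root[OF v] by blast
    then have "(v, w) \<in> (parcs H)\<^sup>*"
      using reachable_rtranclI by fastforce
    then obtain n where "(v, w) \<in> parcs H ^^ n"
      using rtrancl_power by blast
    with w show ?thesis unfolding near_def by blast
  qed
  have "\<exists>u. (v, u) \<in> parcs H \<and> rk u < rk v" if v: "v \<in> pverts G - S" for v
  proof -
    have "near v (rk v)"
      using near_ex v unfolding rk_def by (metis DiffD1 LeastI)
    then obtain w where w: "w \<in> S" "(v, w) \<in> parcs H ^^ rk v"
      unfolding near_def by blast
    with v obtain k where k: "rk v = Suc k"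
      by (cases "rk v") auto
    with w(2) obtain u where u: "(v, u) \<in> parcs H" "(u, w) \<in> parcs H ^^ k"
      by (metis relpow_Suc_D2)
    then have "near u k"
      using w unfolding near_def by blast
    then have "rk u \<le> k"
      unfolding rk_def by (rule Least_le)
    with u k show ?thesis by auto
  qed
  then obtain f where f: "\<And>v. v \<in> pverts G - S \<Longrightarrow> (v, f v) \<in> parcs H \<and> rk (f v) < rk v"
    by metis
  define p where "p = restrict f (pverts G - S)"
  have p: "p \<in> parent_functions G S"
    using f sub unfolding p_def parent_functions_def by (auto simp del: Diff_iff)
  have p_arc: "(v, p v) \<in> parcs H" and p_rk: "rk (p v) < rk v" if "v \<in> pverts G - S" for v
    using f that by (auto simp: p_def)
  let ?T = "parent_forest G S p"
  interpret T: pair_sym_digraph ?T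
    using pair_sym_digraph_parent_forest[of G S p] p G.pair_wf_digraph_axioms
    unfolding parent_functions_def by blast
  have TH: "parcs ?T \<subseteq> parcs H"
    using p_arc symH by (auto simp: parcs_parent_forest)
  have "parcs H \<subseteq> parcs ?T"
  proof (rule subrelI, rule ccontr)
    fix u v assume uv: "(u, v) \<in> parcs H" and notT: "(u, v) \<notin> parcs ?T"
    have "u \<in> pverts G" "v \<in> pverts G"
      using H.in_arcsD1 H.in_arcsD2 uv verts by auto
    have reach_mono: "a \<rightarrow>\<^sup>*\<^bsub>with_proj H\<^esub> b" if "a \<rightarrow>\<^sup>*\<^bsub>with_proj ?T\<^esub> b" for a b
      using that rtrancl_on_mono[OF TH] verts by (auto simp: reachable_def)
    obtain a where a: "a \<in> S" "u \<rightarrow>\<^sup>*\<^bsub>with_proj ?T\<^esub> a"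
      using parent_forest_reaches_unique_root[where rk = rk, OF T.pair_wf_digraph_axioms p_rk \<open>u \<in> pverts G\<close>]
      by blast
    obtain b where b: "b \<in> S" "v \<rightarrow>\<^sup>*\<^bsub>with_proj ?T\<^esub> b"
      using parent_forest_reaches_unique_root[where rk = rk, OF T.pair_wf_digraph_axioms p_rk \<open>v \<in> pverts G\<close>]
      by blast
    have "u \<rightarrow>\<^sup>*\<^bsub>with_proj H\<^esub> b"
      using H.adj_reachable_trans[of u v b] uv reach_mono[OF b(2)] by simp
    \<comment> \<open>Both roots are reachable from \<open>u\<close> in \<open>H\<close>, and a
      component of \<open>H\<close> contains only one root; going through this common root links
      \<open>u\<close> to \<open>v\<close> within the smaller forest.\<close>
    then have "a = b"
      using root[OF \<open>u \<in> pverts G\<close>] reach_mono[OF a(2)] a(1) b(1) by blast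
    then have "u \<rightarrow>\<^sup>*\<^bsub>with_proj ?T\<^esub> v"
      using a(2) T.symmetric_reachable'[OF b(2)] T.reachable_trans by blast
    then obtain q where q: "T.apath u q v"
      using T.reachable_apath by blast
    then have walk: "T.awalk u q v" and dist: "distinct (pawalk_verts u q)"
      by (auto simp: T.apath_def)
    have "u \<noteq> v"
      using G.pair_no_loops[of "(u, v)"] uv sub by auto
    \<comment> \<open>No arc would mean \<open>u = v\<close>, and a single arc would be
      \<open>(u, v)\<close> itself. Two arcs and the edge back reach the length 3 from which
      \<open>undirected_acyclic\<close> forbids cycles.\<close>
    then have "2 \<le> length q"
      using walk notT by (cases q; cases "tl q") (auto simp: T.awalk_def)
    moreover have "H.awalk u q v"
      using walk TH verts by (auto simp: T.awalk_def H.awalk_def)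
    \<comment> \<open>Starting the cycle at \<open>v\<close> makes the tail of its vertex list the
      vertex list of the path \<open>q\<close>, which is distinct.\<close>
    moreover have "H.cycle ((v, u) # q)"
      unfolding H.cycle_def using calculation(2) dist symH[OF uv]
      by (intro exI[of _ v]) (auto simp: H.awalk_Cons_iff)
    ultimately show False
      using acyc by (auto simp: undirected_acyclic_def intro!: exI[of _ "(v, u) # q"])
  qed
  with TH verts have "H = ?T"
    by (intro pair_pre_digraph.equality) auto
  with p show thesis using that by blast
qed

theorem num_rooted_spanning_forests_eq_card_parent_functions:
  assumes "pair_bidirected_digraph G"
  shows "num_rooted_spanning_forests G S = card (parent_functions G S)"
proof -
  interpret pair_bidirected_digraph G by fact
  have "sym (parcs G)"
    using pair_sym_arcs by (simp add: symmetric_def)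
  then have "parent_forest G S p \<in> {H. rooted_spanning_forest G S H}"
    if "p \<in> parent_functions G S" for p
    using rooted_spanning_forest_parent_forest[OF pair_wf_digraph_axioms that] by simp
  moreover have "H \<in> parent_forest G S ` parent_functions G S"
    if "rooted_spanning_forest G S H" for H
    using rooted_spanning_forest_imp_parent_forest[OF pair_loopfree_digraph_axioms that] by blast
  ultimately have image: "parent_forest G S ` parent_functions G S = {H. rooted_spanning_forest G S H}"
    by blast
  show ?thesis
    unfolding num_rooted_spanning_forests_def image[symmetric]
    by (rule card_image[OF inj_on_parent_forest])
qed

section \<open>Words avoiding mutual parents\<close>

text \<open>
  Reading the rim from a root onwards, a letter tells whether a vertex is a root (\<open>Stay\<close>) or else
  which of its three neighbours in the wheel is its parent.
\<close>

datatype move = Stay | Hub | Forth | Back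

text \<open>The forbidden factor is a vertex and its successor that name each other as parents. The
  word is read linearly: the factor is not tested between the last letter and the first.\<close>

definition admissible :: "bool list \<Rightarrow> move list set" where
  "admissible bs =
     {xs. map (\<lambda>x. x = Stay) xs = bs \<and> successively (\<lambda>x y. \<not> (x = Forth \<and> y = Back)) xs}"

definition block :: "nat \<Rightarrow> bool list" where
  "block d = True # replicate (d - 1) False"

lemma finite_admissible: "finite (admissible bs)"
proof (rule finite_subset)
  have "x \<in> {Stay, Hub, Forth, Back}" for x
    by (cases x) auto
  then show "admissible bs \<subseteq> {xs. set xs \<subseteq> {Stay, Hub, Forth, Back} \<and> length xs = length bs}"
    by (auto simp: admissible_def simp del: insert_iff)
  show "finite {xs. set xs \<subseteq> {Stay, Hub, Forth, Back} \<and> length xs = length bs}"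
    by (rule finite_lists_length_eq) simp
qed

text \<open>\<open>B m\<close> holds the words that may follow \<open>Forth\<close>. Splitting by
  the first letter, \<open>A (Suc m)\<close> has twice as many words as \<open>A m\<close> plus
  those of \<open>B m\<close>, and \<open>B (Suc m)\<close> as many as \<open>A m\<close> and
  \<open>B m\<close> together; this is the Fibonacci recursion over even and odd indices.\<close>

lemma card_admissible_replicate_False:
  defines "A \<equiv> \<lambda>m. admissible (replicate m False)"
    and "B \<equiv> \<lambda>m. {xs \<in> admissible (replicate m False). xs = [] \<or> hd xs \<noteq> Back}"
  shows "card (A m) = fib (2 * m + 2)" and "card (B m) = fib (2 * m + 1)"
proof -
  have fin: "finite (A m)" "finite (B m)" for m
    using finite_admissible by (auto simp: A_def B_def)
  have A: "A (Suc m) = (#) Hub ` A m \<union> (#) Back ` A m \<union> (#) Forth ` B m" for m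
  proof (rule set_eqI)
    fix xs show "xs \<in> A (Suc m) \<longleftrightarrow> xs \<in> (#) Hub ` A m \<union> (#) Back ` A m \<union> (#) Forth ` B m"
    proof (cases xs)
      case (Cons x ys)
      then show ?thesis
        by (cases x) (auto simp: A_def B_def admissible_def successively_Cons)
    qed (auto simp: A_def admissible_def)
  qed
  have B: "B (Suc m) = (#) Hub ` A m \<union> (#) Forth ` B m" for m
  proof (rule set_eqI)
    fix xs show "xs \<in> B (Suc m) \<longleftrightarrow> xs \<in> (#) Hub ` A m \<union> (#) Forth ` B m"
    proof (cases xs)
      case (Cons x ys)
      then show ?thesis
        by (cases x) (auto simp: A_def B_def admissible_def successively_Cons)
    qed (auto simp: B_def admissible_def)
  qed
  have "card (A m) = fib (2 * m + 2) \<and> card (B m) = fib (2 * m + 1)"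
  proof (induction m)
    case 0
    have "A 0 = {[]}" "B 0 = {[]}"
      by (auto simp: A_def B_def admissible_def)
    then show ?case by simp
  next
    case (Suc m)
    have "card (A (Suc m)) = card (A m) + card (A m) + card (B m)"
    proof -
      have "card (A (Suc m)) = card ((#) Hub ` A m \<union> (#) Back ` A m) + card ((#) Forth ` B m)"
        unfolding A using fin by (intro card_Un_disjoint) auto
      also have "card ((#) Hub ` A m \<union> (#) Back ` A m) = card ((#) Hub ` A m) + card ((#) Back ` A m)"
        using fin by (intro card_Un_disjoint) auto
      finally show ?thesis by (simp add: card_image)
    qed
    moreover have "card (B (Suc m)) = card (A m) + card (B m)"
      unfolding B using fin by (subst card_Un_disjoint) (auto simp: card_image)
    ultimately show ?case
      using Suc by simp
  qed
  then show "card (A m) = fib (2 * m + 2)" and "card (B m) = fib (2 * m + 1)"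
    by blast+
qed

text \<open>A root separates its two neighbours, so no condition links consecutive blocks.\<close>

lemma card_admissible_append:
  assumes "bs = [] \<or> hd bs"
  shows "card (admissible (True # replicate m False @ bs)) = fib (2 * m + 2) * card (admissible bs)"
proof -
  have eq: "admissible (True # replicate m False @ bs) =
      (\<lambda>(u, v). Stay # u @ v) ` (admissible (replicate m False) \<times> admissible bs)" (is "?L = ?f ` ?P")
  proof (intro equalityI subsetI)
    fix xs assume "xs \<in> ?L"
    then obtain u v where "xs = Stay # u @ v" "map (\<lambda>x. x = Stay) u = replicate m False"
        "map (\<lambda>x. x = Stay) v = bs" "successively (\<lambda>x y. \<not> (x = Forth \<and> y = Back)) xs"
      by (auto simp: admissible_def map_eq_Cons_conv map_eq_append_conv)
    then show "xs \<in> ?f ` ?P"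
      by (auto simp: admissible_def successively_Cons successively_append_iff
          intro!: image_eqI[of _ _ "(u, v)"])
  next
    fix xs assume "xs \<in> ?f ` ?P"
    then obtain u v where "xs = Stay # u @ v" "u \<in> admissible (replicate m False)" "v \<in> admissible bs"
      by auto
    moreover from this have "v = [] \<or> hd v = Stay"
      using assms by (cases v) (auto simp: admissible_def)
    ultimately show "xs \<in> ?L"
      by (auto simp: admissible_def successively_Cons successively_append_iff)
  qed
  \<comment> \<open>The split into \<open>u\<close> and \<open>v\<close> is unique because
    \<open>u\<close> always has length \<open>m\<close>.\<close>
  have len: "length u = m" if "u \<in> admissible (replicate m False)" for u
    using that by (auto simp: admissible_def dest: map_eq_imp_length_eq arg_cong[of _ _ length])
  have "inj_on ?f ?P"
    using len by (auto simp: inj_on_def)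
  then show ?thesis
    unfolding eq by (simp add: card_image card_cartesian_product card_admissible_replicate_False(1)
        del: fib.simps)
qed

lemma card_admissible_blocks:
  assumes "\<forall>d \<in> set ds. 0 < d"
  shows "card (admissible (concat (map block ds))) = (\<Prod>d\<leftarrow>ds. fib (2 * d))"
  using assms
proof (induction ds)
  case Nil
  have "admissible [] = {[]}" by (auto simp: admissible_def)
  then show ?case by simp
next
  case (Cons d ds)
  have "concat (map block ds) = [] \<or> hd (concat (map block ds))"
    by (cases ds) (auto simp: block_def)
  \<comment> \<open>A block of length \<open>d\<close> has \<open>d - 1\<close> non-roots, so its
    factor has index \<open>2 * d\<close>; truncated subtraction makes \<open>0 < d\<close>
    matter.\<close>
  moreover have "2 * (d - 1) + 2 = 2 * d"
    using Cons.prems by (cases d) auto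
  ultimately show ?case
    using Cons card_admissible_append[of "concat (map block ds)" "d - 1"]
    by (simp add: block_def[of d])
qed

section \<open>Cyclic intervals and compositions\<close>

text \<open>Recursive form of the cyclic intervals: \<open>M\<close> closes the last gap, and
  \<open>M = hd a + N\<close> makes it wrap around the rim.\<close>

fun gaps :: "nat list \<Rightarrow> nat \<Rightarrow> nat list" where
  "gaps [] M = []"
| "gaps [x] M = [M - x]"
| "gaps (x # y # zs) M = (y - x) # gaps (y # zs) M"

lemma gaps_conv_nth:
  "a \<noteq> [] \<Longrightarrow> gaps a M = map (\<lambda>i. a ! (i + 1) - a ! i) [0..<length a - 1] @ [M - last a]"
proof (induction a M rule: gaps.induct)
  case (3 x y zs M)
  have "[0..<length (x # y # zs) - 1] = 0 # map Suc [0..<length (y # zs) - 1]"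
    by (simp add: map_Suc_upt upt_conv_Cons del: upt_Suc)
  with 3 show ?case
    by (simp del: upt_Suc)
qed simp_all

lemma length_gaps [simp]: "length (gaps a M) = length a"
  by (induction a M rule: gaps.induct) auto

lemma gaps_pos:
  "sorted_wrt (<) a \<Longrightarrow> \<forall>x \<in> set a. x < M \<Longrightarrow> d \<in> set (gaps a M) \<Longrightarrow> 0 < d"
  by (induction a M rule: gaps.induct) auto

lemma sum_list_gaps:
  "a \<noteq> [] \<Longrightarrow> sorted_wrt (<) a \<Longrightarrow> \<forall>x \<in> set a. x < M \<Longrightarrow> sum_list (gaps a M) = M - hd a"
  by (induction a M rule: gaps.induct) auto

text \<open>Links root sets to block words: cutting the range before each root leaves pieces that
  start with a root and contain no other.\<close>

lemma map_mem_eq_blocks_gaps: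
  "a \<noteq> [] \<Longrightarrow> sorted_wrt (<) a \<Longrightarrow> \<forall>x \<in> set a. x < M \<Longrightarrow>
     map (\<lambda>x. x \<in> set a) [hd a..<M] = concat (map block (gaps a M))"
proof (induction a M rule: gaps.induct)
  case (2 x M)
  then have "[x..<M] = x # [Suc x..<M]" by (simp add: upt_conv_Cons)
  moreover have "map (\<lambda>z. z \<in> set [x]) [Suc x..<M] = map (\<lambda>_. False) [Suc x..<M]"
    by (intro map_cong) auto
  ultimately show ?case
    by (simp add: block_def map_replicate_const)
next
  case (3 x y zs M)
  have split: "[x..<M] = x # [Suc x..<y] @ [y..<M]"
  proof -
    have "x < y" "y < M" using 3 by auto
    then have "[x..<M] = [x..<y] @ [y..<M]"
      by (metis le_add_diff_inverse less_imp_le upt_add_eq_append)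
    then show ?thesis using \<open>x < y\<close> by (simp add: upt_conv_Cons)
  qed
  have "map (\<lambda>z. z \<in> set (x # y # zs)) [Suc x..<y] = map (\<lambda>_. False) [Suc x..<y]"
    using 3 by (intro map_cong) auto
  also have "\<dots> = replicate (y - x - 1) False"
    by (simp add: map_replicate_const)
  finally have 1: "map (\<lambda>z. z \<in> set (x # y # zs)) [Suc x..<y] = replicate (y - x - 1) False" .
  have 2: "map (\<lambda>z. z \<in> set (x # y # zs)) [y..<M] = map (\<lambda>z. z \<in> set (y # zs)) [y..<M]"
    using 3 by (intro map_cong) auto
  show ?case
    using 3 by (simp only: split 1 2 list.sel list.map map_append gaps.simps concat.simps)
      (simp add: block_def[of "y - x"])
qed simp

section \<open>Root sets with prescribed intervals\<close>

fun partial_sums :: "nat \<Rightarrow> nat list \<Rightarrow> nat list" where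
  "partial_sums x [] = []"
| "partial_sums x (d # ds) = x # partial_sums (x + d) ds"

lemma length_partial_sums [simp]: "length (partial_sums x ds) = length ds"
  by (induction x ds rule: partial_sums.induct) auto

lemma gaps_partial_sums: "gaps (partial_sums x ds) (x + sum_list ds) = ds"
proof (induction x ds rule: partial_sums.induct)
  case (2 x d ds)
  then show ?case by (cases ds) (auto simp: add.assoc)
qed simp

lemma set_partial_sums:
  "\<forall>d \<in> set ds. 0 < d \<Longrightarrow> set (partial_sums x ds) \<subseteq> {x..<x + sum_list ds}"
  by (induction x ds rule: partial_sums.induct) fastforce+

lemma sorted_partial_sums:
  "\<forall>d \<in> set ds. 0 < d \<Longrightarrow> sorted_wrt (<) (partial_sums x ds)"
proof (induction x ds rule: partial_sums.induct)
  case (2 x d ds)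
  then show ?case using set_partial_sums[of ds "x + d"] by fastforce
qed simp

definition root_list :: "wheel_vertex set \<Rightarrow> nat list" where
  "root_list R = sorted_list_of_set {i. Rim i \<in> R}"

lemma root_list:
  assumes "R \<subseteq> rim N" and "R \<noteq> {}"
  shows "sorted_wrt (<) (root_list R)" and "set (root_list R) = {i. Rim i \<in> R}"
    and "set (root_list R) \<subseteq> {1..N}" and "length (root_list R) = card R" and "root_list R \<noteq> []"
proof -
  have sub: "{i. Rim i \<in> R} \<subseteq> {1..N}"
    using assms by (auto simp: rim_def)
  then have fin: "finite {i. Rim i \<in> R}"
    using finite_subset by blast
  have R: "R = Rim ` {i. Rim i \<in> R}"
    using assms by (auto simp: rim_def)
  have "card R = card {i. Rim i \<in> R}"
    by (subst R, rule card_image) (simp add: inj_on_def)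
  then show "length (root_list R) = card R"
    by (simp add: root_list_def)
  show "sorted_wrt (<) (root_list R)" "set (root_list R) = {i. Rim i \<in> R}" "set (root_list R) \<subseteq> {1..N}"
    using fin sub by (simp_all add: root_list_def)
  with R assms(2) show "root_list R \<noteq> []" by fastforce
qed

lemma cyclic_intervals_eq_gaps:
  assumes "R \<subseteq> rim N" and "R \<noteq> {}"
  shows "cyclic_intervals N R = gaps (root_list R) (hd (root_list R) + N)"
  using gaps_conv_nth[OF root_list(5)[OF assms]]
  by (simp add: cyclic_intervals_def root_list_def Let_def)

lemma root_list_less:
  assumes "R \<subseteq> rim N" and "R \<noteq> {}"
  shows "\<forall>x \<in> set (root_list R). x < hd (root_list R) + N"
proof
  fix x assume x: "x \<in> set (root_list R)"
  have "hd (root_list R) \<in> set (root_list R)"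
    using root_list(5)[OF assms] by simp
  with x have "hd (root_list R) \<in> {1..N}" "x \<in> {1..N}"
    using root_list(3)[OF assms] by blast+
  then show "x < hd (root_list R) + N"
    by simp
qed

lemma cyclic_intervals_composition:
  assumes "R \<subseteq> rim N" and "R \<noteq> {}"
  shows "length (cyclic_intervals N R) = card R" and "\<forall>d \<in> set (cyclic_intervals N R). 0 < d"
    and "sum_list (cyclic_intervals N R) = N"
  unfolding cyclic_intervals_eq_gaps[OF assms]
  using root_list(4)[OF assms] gaps_pos[OF root_list(1)[OF assms] root_list_less[OF assms]]
    sum_list_gaps[OF root_list(5,1)[OF assms] root_list_less[OF assms]]
  by auto

text \<open>Needed to attain both extreme values: placing roots at the partial sums of a composition
  inverts \<open>gaps\<close>.\<close>

lemma composition_is_cyclic_intervals: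
  assumes "ds \<noteq> []" and "\<forall>d \<in> set ds. 0 < d" and "sum_list ds = N"
  obtains R where "R \<subseteq> rim N" and "card R = length ds" and "cyclic_intervals N R = ds"
proof
  \<comment> \<open>Starting at 1 keeps all sums within \<open>{1..N}\<close>, and the closing value
    \<open>1 + N\<close> is \<open>hd ?a + N\<close>.\<close>
  let ?a = "partial_sums 1 ds"
  let ?R = "Rim ` set ?a"
  have sub: "set ?a \<subseteq> {1..<1 + N}"
    using set_partial_sums[OF assms(2), of 1] assms(3) by simp
  then show "?R \<subseteq> rim N"
    by (auto simp: rim_def)
  have "{i. Rim i \<in> ?R} = set ?a" by auto
  then have a: "root_list ?R = ?a"
    using sorted_partial_sums[OF assms(2), of 1]
    by (simp add: root_list_def strict_sorted_iff sorted_list_of_set.idem_if_sorted_distinct)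
  have ne: "?R \<noteq> {}" using assms(1) by (cases ds) auto
  show "card ?R = length ds"
    using root_list(4)[OF \<open>?R \<subseteq> rim N\<close> ne] a by simp
  have hd: "hd ?a = 1" using assms(1) by (cases ds) auto
  show "cyclic_intervals N ?R = ds"
    unfolding cyclic_intervals_eq_gaps[OF \<open>?R \<subseteq> rim N\<close> ne] a hd
    using gaps_partial_sums[of 1 ds] assms(3) by simp
qed

section \<open>Forests of the wheel\<close>

text \<open>The rim is cut open at a root \<open>b\<close>. As a root has no parent, no pair of
  mutual parents straddles the cut, and linear words suffice.\<close>

locale rooted_wheel =
  fixes N :: nat and R :: "wheel_vertex set" and b :: nat
  assumes N: "3 \<le> N" and R: "R \<subseteq> rim N" and b: "Rim b \<in> R"
begin

text \<open>
  Positions \<open>0, \<dots>, N - 1\<close> count the rim vertices \<open>1, \<dots>, N\<close> cyclically, starting at the root \<open>b\<close>.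
\<close>

definition pos :: "nat \<Rightarrow> nat" where
  "pos j = (b + j - 1) mod N + 1"

text \<open>Inverse of \<open>pos\<close> on the positions below \<open>N\<close>. Adding
  \<open>N\<close> first keeps the truncated subtraction exact, as \<open>b \<le> N\<close>.\<close>

definition idx :: "nat \<Rightarrow> nat" where
  "idx i = (i + N - b) mod N"

lemma b_bounds: "1 \<le> b" "b \<le> N"
  using b R by (auto simp: rim_def)

lemma pos_bounds: "1 \<le> pos j" "pos j \<le> N"
  using N by (auto simp: pos_def Suc_le_eq)

lemma Rim_pos_in_rim: "Rim (pos j) \<in> rim N"
  using pos_bounds by (auto simp: rim_def)

lemma idx_less: "idx i < N"
  using N by (simp add: idx_def)

lemma idx_pos: "idx (pos j) = j mod N"
proof -
  have "idx (pos j) = ((b + j - 1) mod N + (1 + N - b)) mod N"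
    using b_bounds by (simp add: idx_def pos_def)
  also have "\<dots> = ((b + j - 1) + (1 + N - b)) mod N"
    by (simp add: mod_add_left_eq)
  also have "(b + j - 1) + (1 + N - b) = j + N"
    using b_bounds by simp
  finally show ?thesis by simp
qed

lemma pos_mod: "pos (j mod N) = pos j"
proof -
  have "(b - 1 + j mod N) mod N = (b - 1 + j) mod N"
    by (simp add: mod_add_right_eq)
  then show ?thesis using b_bounds by (simp add: pos_def)
qed

lemma pos_eq_iff: "pos i = pos j \<longleftrightarrow> i mod N = j mod N"
  by (metis idx_pos pos_mod)

lemma pos_idx:
  assumes "1 \<le> i" "i \<le> N"
  shows "pos (idx i) = i"
proof -
  have "pos (idx i) = (b - 1 + (i + N - b)) mod N + 1"
    using b_bounds pos_mod[of "i + N - b"] by (simp add: idx_def pos_def)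
  also have "b - 1 + (i + N - b) = i - 1 + N"
    using assms b_bounds by simp
  also have "(i - 1 + N) mod N = i - 1"
    using assms by (subst mod_add_self2) simp
  finally show ?thesis using assms by simp
qed

lemma pos_0: "pos 0 = b" and pos_N: "pos N = b"
proof -
  show "pos 0 = b" using b_bounds by (simp add: pos_def)
  then show "pos N = b" using pos_eq_iff[of N 0] by simp
qed

lemma pos_Suc: "pos j mod N + 1 = pos (Suc j)"
proof -
  have "pos (Suc j) = (b - 1 + j + 1) mod N + 1"
    using b_bounds by (simp add: pos_def)
  moreover have "pos j mod N = (b - 1 + j + 1) mod N"
    using b_bounds by (simp add: pos_def mod_Suc_eq)
  ultimately show ?thesis by simp
qed

lemma rim_cases:
  assumes "v \<in> rim N"
  obtains j where "j < N" and "v = Rim (pos j)"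
  using assms pos_idx idx_less by (auto simp: rim_def) (metis Suc_leI)

text \<open>\<open>j + (N - 1)\<close> is the predecessor of \<open>j\<close> modulo
  \<open>N\<close>. Giving \<open>Stay\<close> the vertex itself keeps the four targets
  distinct.\<close>

definition target :: "nat \<Rightarrow> move \<Rightarrow> wheel_vertex" where
  "target j m = (case m of Stay \<Rightarrow> Rim (pos j) | Hub \<Rightarrow> Center
     | Forth \<Rightarrow> Rim (pos (Suc j)) | Back \<Rightarrow> Rim (pos (j + (N - 1))))"

lemma target_inj: "target j m = target j m' \<longleftrightarrow> m = m'"
proof -
  \<comment> \<open>The shifts 0, 1 and \<open>N - 1\<close> are distinct residues because
    \<open>3 \<le> N\<close>; for \<open>N = 2\<close> the two rim neighbours would
    coincide.\<close>
  have "\<not> [j + 0 = j + 1] (mod N)" "\<not> [j + 0 = j + (N - 1)] (mod N)" "\<not> [j + 1 = j + (N - 1)] (mod N)"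
    using N by (simp_all only: cong_add_lcancel_nat) (simp_all add: cong_def)
  then have "pos j \<noteq> pos (Suc j)" "pos j \<noteq> pos (j + (N - 1))" "pos (Suc j) \<noteq> pos (j + (N - 1))"
    by (simp_all add: pos_eq_iff cong_def)
  then show ?thesis
    by (cases m; cases m') (auto simp: target_def)
qed

lemma pos_Suc_pred: "pos (Suc (j + (N - 1))) = pos j"
  using N by (simp add: pos_eq_iff)

lemma wheel_arcs_eq:
  "wheel_arcs N = (\<lambda>j. (Rim (pos j), Rim (pos (Suc j)))) ` UNIV \<union> (\<lambda>j. (Center, Rim (pos j))) ` UNIV"
proof -
  have ex: "\<exists>j. i = pos j" if "i \<in> {1..N}" for i
    using pos_idx[of i] that by (metis atLeastAtMost_iff)
  have "pos j \<in> {1..N}" for j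
    using pos_bounds by simp
  with ex show ?thesis
    unfolding wheel_arcs_def pos_Suc[symmetric] by blast
qed

lemma wheel_out_arcs:
  "(Rim (pos j), w) \<in> parcs (wheel N) \<longleftrightarrow> (\<exists>m. m \<noteq> Stay \<and> w = target j m)"
proof -
  have "(Rim (pos j), w) \<in> parcs (wheel N) \<longleftrightarrow>
      w = Center \<or> w = Rim (pos (Suc j)) \<or> w = Rim (pos (j + (N - 1)))" (is "?L \<longleftrightarrow> ?R")
  proof
    assume ?L
    then consider k where "pos j = pos k" "w = Rim (pos (Suc k))"
      | k where "pos j = pos (Suc k)" "w = Rim (pos k)" | "w = Center"
      by (auto simp: wheel_def wheel_arcs_eq)
    then show ?R
    proof cases
      case 1
      then have "pos (Suc k) = pos (Suc j)"
        by (metis pos_Suc)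
      with 1 show ?thesis by simp
    next
      case 2
      then have "(j + (N - 1)) mod N = (Suc k + (N - 1)) mod N"
        by (metis mod_add_left_eq pos_eq_iff)
      also have "Suc k + (N - 1) = k + N" using N by simp
      finally have "pos k = pos (j + (N - 1))"
        by (simp add: pos_eq_iff)
      with 2 show ?thesis by simp
    qed simp
  next
    assume ?R
    then show ?L
      using pos_Suc_pred[of j] by (auto simp: wheel_def wheel_arcs_eq)
  qed
  moreover have "(\<exists>m. m \<noteq> Stay \<and> w = target j m) \<longleftrightarrow>
      w = target j Hub \<or> w = target j Forth \<or> w = target j Back"
    by (metis move.distinct move.exhaust)
  ultimately show ?thesis
    by (simp add: target_def)
qed

section \<open>Words as parent functions of the wheel\<close>

definition pattern :: "bool list" where
  "pattern = map (\<lambda>j. Rim (pos j) \<in> R) [0..<N]"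

definition parent_of_word :: "move list \<Rightarrow> wheel_vertex \<Rightarrow> wheel_vertex" where
  "parent_of_word xs =
     restrict (\<lambda>v. case v of Center \<Rightarrow> Center | Rim i \<Rightarrow> target (idx i) (xs ! idx i)) (rim N - R)"

lemma parent_of_word_pos:
  "j < N \<Longrightarrow> Rim (pos j) \<notin> R \<Longrightarrow> parent_of_word xs (Rim (pos j)) = target j (xs ! j)"
  using Rim_pos_in_rim by (simp add: parent_of_word_def idx_pos)

lemma admissible_pattern_iff:
  "xs \<in> admissible pattern \<longleftrightarrow>
     length xs = N \<and> (\<forall>j<N. xs ! j = Stay \<longleftrightarrow> Rim (pos j) \<in> R) \<and>
     (\<forall>j. Suc j < N \<longrightarrow> \<not> (xs ! j = Forth \<and> xs ! Suc j = Back))"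
proof -
  have "map (\<lambda>x. x = Stay) xs = pattern \<longleftrightarrow>
      length xs = N \<and> (\<forall>j<N. xs ! j = Stay \<longleftrightarrow> Rim (pos j) \<in> R)"
    unfolding pattern_def list_eq_iff_nth_eq by fastforce
  then show ?thesis
    unfolding admissible_def mem_Collect_eq successively_conv_nth by blast
qed

lemma non_roots: "pverts (wheel N) - insert Center R = rim N - R"
  by (auto simp: wheel_def rim_def)

lemma parent_of_word_in_parent_functions:
  assumes xs: "xs \<in> admissible pattern"
  shows "parent_of_word xs \<in> parent_functions (wheel N) (insert Center R)"
proof -
  \<comment> \<open>A run of \<open>Forth\<close> moves to higher positions and a run of
    \<open>Back\<close> to lower ones, so the rank falls along each. Neither run can turn into the
    other; it ends at a root or at a \<open>Hub\<close> vertex, whose ranks 0 and 1 lie below the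
    offset 2.\<close>
  define rk where "rk v = (case v of Center \<Rightarrow> 0 | Rim i \<Rightarrow>
      if Rim i \<in> R then 0
      else (case xs ! idx i of Forth \<Rightarrow> 2 + (N - idx i) | Back \<Rightarrow> 2 + idx i | _ \<Rightarrow> 1))" for v
  have rk_pos: "rk (Rim (pos j)) = (if Rim (pos j) \<in> R then 0
      else (case xs ! j of Forth \<Rightarrow> 2 + (N - j) | Back \<Rightarrow> 2 + j | _ \<Rightarrow> 1))" if "j < N" for j
    using that by (simp add: rk_def idx_pos cong: move.case_cong)
  have root0: "rk (Rim b) = 0"
    using b by (simp add: rk_def)
  have key: "(v, parent_of_word xs v) \<in> parcs (wheel N) \<and> rk (parent_of_word xs v) < rk v"
    if v: "v \<in> rim N - R" for v
  proof -
    from v obtain j where j: "j < N" "v = Rim (pos j)" "Rim (pos j) \<notin> R"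
      by (auto elim: rim_cases)
    \<comment> \<open>Position 0 is the root \<open>b\<close>, so the predecessor of a non-root does
      not wrap around.\<close>
    then have "j \<noteq> 0" using b pos_0 by (metis)
    have nonStay: "xs ! j \<noteq> Stay"
      using xs j by (simp add: admissible_pattern_iff)
    have p: "parent_of_word xs v = target j (xs ! j)"
      using j parent_of_word_pos by simp
    have "rk (target j (xs ! j)) < rk v"
    proof (cases "xs ! j")
      case Hub
      then show ?thesis using j by (simp add: target_def rk_pos) (simp add: rk_def)
    next
      case Forth
      show ?thesis
      proof (cases "Suc j = N")
        case True
        \<comment> \<open>From the last position \<open>Forth\<close> crosses the cut and lands on
          \<open>b\<close>, of rank 0.\<close>
        then show ?thesis using Forth j root0 pos_N by (simp add: target_def rk_pos)
      next
        case False
        then have "Suc j < N" using j by simp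
        moreover have "xs ! Suc j \<noteq> Back"
          using xs Forth calculation by (auto simp: admissible_pattern_iff)
        ultimately show ?thesis
          using Forth j by (cases "xs ! Suc j") (auto simp: target_def rk_pos)
      qed
    next
      case Back
      obtain k where k: "j = Suc k" using \<open>j \<noteq> 0\<close> not0_implies_Suc by blast
      have "pos (j + (N - 1)) = pos k"
        using N by (simp add: pos_eq_iff k)
      moreover have "xs ! k \<noteq> Forth"
        using xs Back j k by (auto simp: admissible_pattern_iff)
      ultimately show ?thesis
        using Back j k by (cases "xs ! k") (auto simp: target_def rk_pos)
    qed (use nonStay in simp)
    moreover have "(v, target j (xs ! j)) \<in> parcs (wheel N)"
      using nonStay j wheel_out_arcs by blast
    ultimately show ?thesis by (simp add: p)
  qed
  have "parent_of_word xs \<in> extensional (rim N - R)"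
    by (simp add: parent_of_word_def)
  with key show ?thesis
    unfolding parent_functions_def non_roots by blast
qed

lemma inj_on_parent_of_word: "inj_on parent_of_word (admissible pattern)"
proof (rule inj_onI)
  fix xs ys assume xs: "xs \<in> admissible pattern" and ys: "ys \<in> admissible pattern"
    and eq: "parent_of_word xs = parent_of_word ys"
  show "xs = ys"
  proof (rule nth_equalityI)
    show "length xs = length ys" using xs ys by (simp add: admissible_pattern_iff)
    fix j assume "j < length xs"
    then have j: "j < N" using xs by (simp add: admissible_pattern_iff)
    show "xs ! j = ys ! j"
    proof (cases "Rim (pos j) \<in> R")
      case True
      then show ?thesis using xs ys j unfolding admissible_pattern_iff by metis
    next
      case False
      then have "target j (xs ! j) = target j (ys ! j)"
        using parent_of_word_pos[OF j] eq by metis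
      then show ?thesis by (simp add: target_inj)
    qed
  qed
qed

lemma parent_functions_imp_parent_of_word:
  assumes p: "p \<in> parent_functions (wheel N) (insert Center R)"
  shows "p \<in> parent_of_word ` admissible pattern"
proof -
  obtain rk :: "wheel_vertex \<Rightarrow> nat" where rk: "\<And>v. v \<in> rim N - R \<Longrightarrow> rk (p v) < rk v"
    and arc: "\<And>v. v \<in> rim N - R \<Longrightarrow> (v, p v) \<in> parcs (wheel N)"
    and ext: "p \<in> extensional (rim N - R)"
    using p unfolding parent_functions_def non_roots by blast
  \<comment> \<open>The parent of a non-root is one of its neighbours, hence the target of a move
    other than \<open>Stay\<close>; roots are assigned \<open>Stay\<close>.\<close>
  have "\<exists>m. (m = Stay \<longleftrightarrow> Rim (pos j) \<in> R) \<and> (Rim (pos j) \<notin> R \<longrightarrow> p (Rim (pos j)) = target j m)" for j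
    using arc[of "Rim (pos j)"] wheel_out_arcs[of j] Rim_pos_in_rim[of j] by blast
  then obtain f where f: "\<And>j. f j = Stay \<longleftrightarrow> Rim (pos j) \<in> R"
      "\<And>j. Rim (pos j) \<notin> R \<Longrightarrow> p (Rim (pos j)) = target j (f j)"
    by metis
  define xs where "xs = map f [0..<N]"
  have nth: "xs ! j = f j" if "j < N" for j
    using that by (simp add: xs_def)
  \<comment> \<open>Such neighbours would be parents of each other, and the rank would have to drop
    in both directions.\<close>
  have no_swap: "\<not> (f j = Forth \<and> f (Suc j) = Back)" for j
  proof
    assume *: "f j = Forth \<and> f (Suc j) = Back"
    then have nr: "Rim (pos j) \<in> rim N - R" "Rim (pos (Suc j)) \<in> rim N - R"
      using f(1)[of j] f(1)[of "Suc j"] Rim_pos_in_rim by auto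
    have "p (Rim (pos j)) = Rim (pos (Suc j))"
      using f(2)[of j] nr * by (simp add: target_def)
    moreover have "p (Rim (pos (Suc j))) = Rim (pos j)"
      using f(2)[of "Suc j"] nr * pos_Suc_pred[of j] by (simp add: target_def)
    ultimately show False
      using rk[OF nr(1)] rk[OF nr(2)] by simp
  qed
  have "xs \<in> admissible pattern"
    using f(1) no_swap nth by (auto simp: admissible_pattern_iff xs_def)
  moreover have "p = parent_of_word xs"
  proof (rule extensionalityI[OF ext])
    show "parent_of_word xs \<in> extensional (rim N - R)"
      by (simp add: parent_of_word_def)
    fix v assume v: "v \<in> rim N - R"
    then obtain j where j: "j < N" "v = Rim (pos j)"
      by (auto elim: rim_cases)
    with v show "p v = parent_of_word xs v"
      using f(2)[of j] nth parent_of_word_pos[of j] by simp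
  qed
  ultimately show ?thesis by blast
qed

lemma num_rooted_spanning_forests_eq_card_admissible:
  "num_rooted_spanning_forests (wheel N) (insert Center R) = card (admissible pattern)"
proof -
  interpret W: pair_graph "wheel N"
    using pair_graph_wheel[OF N] .
  have "parent_of_word ` admissible pattern = parent_functions (wheel N) (insert Center R)"
    using parent_of_word_in_parent_functions parent_functions_imp_parent_of_word by blast
  then have "card (parent_functions (wheel N) (insert Center R)) = card (admissible pattern)"
    using card_image[OF inj_on_parent_of_word] by simp
  then show ?thesis
    using num_rooted_spanning_forests_eq_card_parent_functions[OF W.pair_bidirected_digraph_axioms]
    by simp
qed

end

theorem num_rooted_spanning_forests_wheel:
  assumes N: "3 \<le> N" and R: "R \<subseteq> rim N" and ne: "R \<noteq> {}"
  shows "num_rooted_spanning_forests (wheel N) ({Center} \<union> R) = (\<Prod>d\<leftarrow>cyclic_intervals N R. fib (2 * d))"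
proof -
  note a = root_list[OF R ne]
  \<comment> \<open>Cutting at the smallest root matches the starting point of the cyclic
    intervals.\<close>
  define b where "b = hd (root_list R)"
  have b_in: "b \<in> set (root_list R)" using a(5) by (simp add: b_def)
  then interpret rooted_wheel N R b
    using N R a(2) by unfold_locales auto
  have "Rim (pos j) \<in> R \<longleftrightarrow> b + j \<in> set (root_list R)" if "j < N" for j
  proof (cases "b + j \<le> N")
    case True
    then have "pos j = b + j" using b_bounds by (simp add: pos_def)
    then show ?thesis using a(2) by simp
  next
    case False
    \<comment> \<open>Past \<open>N\<close> both sides are false: \<open>b + j\<close> exceeds every
      root, and \<open>pos j\<close> wraps to a number below the smallest one.\<close>
    then have "b + j \<notin> set (root_list R)" using a(3) by auto
    moreover have "b + j - 1 = (b + j - 1 - N) + N" using False by simp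
    then have "pos j = (b + j - 1 - N) mod N + 1"
      unfolding pos_def by (metis mod_add_self2)
    then have "pos j < b"
      using b_bounds that False by simp
    then have "pos j \<notin> set (root_list R)"
      using a(1,5) unfolding b_def by (cases "root_list R") auto
    ultimately show ?thesis using a(2) by simp
  qed
  then have "pattern = map (\<lambda>j. b + j \<in> set (root_list R)) [0..<N]"
    by (simp add: pattern_def)
  also have "\<dots> = map (\<lambda>x. x \<in> set (root_list R)) (map (\<lambda>j. j + b) [0..<N])"
    by (simp add: add.commute)
  also have "\<dots> = map (\<lambda>x. x \<in> set (root_list R)) [b..<b + N]"
    by (simp only: map_add_upt add_0 add.commute)
  also have "\<dots> = concat (map block (cyclic_intervals N R))"
    unfolding b_def cyclic_intervals_eq_gaps[OF R ne]
    by (rule map_mem_eq_blocks_gaps[OF a(5,1) root_list_less[OF R ne]])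
  finally show ?thesis
    using num_rooted_spanning_forests_eq_card_admissible
      card_admissible_blocks[OF cyclic_intervals_composition(2)[OF R ne]] by simp
qed

section \<open>Optimising products of Fibonacci numbers\<close>

lemma fib_even_mult:
  "fib (2 * a + 2) * fib (2 * b + 2) = fib (2 * (a + b) + 2) + fib (2 * a) * fib (2 * b)"
proof -
  have "fib (2 * (a + b) + 2) = fib (Suc ((2 * b) + (2 * a + 1)))"
    by (simp add: algebra_simps)
  \<comment> \<open>Addition formula; \<open>fib (2 * a + 2) - fib (2 * a + 1) = fib (2 * a)\<close>
    then produces the correction term of the claim.\<close>
  also have "\<dots> = fib (2 * a + 2) * fib (2 * b + 1) + fib (2 * a + 1) * fib (2 * b)"
    by (simp only: fib_add) simp
  finally show ?thesis
    by (simp add: algebra_simps)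
qed

lemma fib_even_pos: "0 < d \<Longrightarrow> 0 < fib (2 * d)"
  by (simp add: fib_neq_0_nat)

text \<open>By \<open>fib_even_mult\<close>, moving the excess over 1 of two entries into one of
  them never increases the product, and preserves it only if one of the two had no excess; an entry
  1 contributes the factor \<open>fib 2 = 1\<close>.\<close>

lemma prod_list_fib_ge:
  assumes "ds \<noteq> []" and "\<forall>d \<in> set ds. 0 < d"
  shows "fib (2 * (sum_list ds - length ds + 1)) \<le> (\<Prod>d\<leftarrow>ds. fib (2 * d))"
    and "(\<Prod>d\<leftarrow>ds. fib (2 * d)) = fib (2 * (sum_list ds - length ds + 1)) \<longleftrightarrow>
         mset ds = mset ((sum_list ds - length ds + 1) # replicate (length ds - 1) 1)"
proof -
  let ?P = "\<lambda>ds. \<Prod>d\<leftarrow>ds. fib (2 * d)"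
  let ?e = "\<lambda>ds :: nat list. sum_list ds - length ds"
  have len: "length ds \<le> sum_list ds" if "\<forall>d \<in> set ds. 0 < d" for ds :: "nat list"
    using that by (induction ds) auto
  have zero: "ds = replicate (length ds) 1" if "\<forall>d \<in> set ds. 0 < d" "?e ds = 0" for ds
    using that
  proof (induction ds)
    case (Cons d ds)
    then have "d = 1" "?e ds = 0" using len[of ds] by auto
    with Cons show ?case by simp
  qed simp
  have "fib (2 * (?e ds + 1)) \<le> ?P ds \<and>
      (?P ds = fib (2 * (?e ds + 1)) \<longrightarrow> mset ds = mset ((?e ds + 1) # replicate (length ds - 1) 1))"
    using assms
  proof (induction ds)
    case (Cons d ds)
    show ?case
    proof (cases "ds = []")
      case True
      then show ?thesis using Cons.prems by auto
    next
      case False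
      \<comment> \<open>\<open>a\<close> and \<open>b\<close> are the excesses over 1 of the head
        and of the whole tail; the induction hypothesis bounds the tail product from below by that
        of the single entry \<open>b + 1\<close>.\<close>
      define a where "a = d - 1"
      define b where "b = ?e ds"
      have d: "d = a + 1" using Cons.prems by (simp add: a_def)
      have ab: "?e (d # ds) = a + b"
        using len[of ds] Cons.prems d by (simp add: b_def)
      have IH: "fib (2 * b + 2) \<le> ?P ds"
        "?P ds = fib (2 * b + 2) \<Longrightarrow> mset ds = mset ((b + 1) # replicate (length ds - 1) 1)"
        using Cons.IH[OF False] Cons.prems by (auto simp: b_def)
      have P: "?P (d # ds) = fib (2 * a + 2) * ?P ds"
        by (simp add: d)
      have pos: "0 < fib (2 * a + 2)" using fib_even_pos[of "a + 1"] by simp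
      have ge: "fib (2 * a + 2) * fib (2 * b + 2) \<le> ?P (d # ds)"
        unfolding P using IH(1) by (rule mult_le_mono2)
      note mult = fib_even_mult[of a b]
      have "mset (d # ds) = mset ((a + b + 1) # replicate (length ds) 1)"
        if eq: "?P (d # ds) = fib (2 * (a + b) + 2)"
      proof -
        \<comment> \<open>Equality leaves no room in \<open>ge\<close> and \<open>mult\<close>: the
          correction term vanishes and the tail attains its own bound.\<close>
        have "fib (2 * a) * fib (2 * b) = 0"
          using eq ge mult by linarith
        then have "a = 0 \<or> b = 0"
          using fib_even_pos[of a] fib_even_pos[of b] by fastforce
        moreover have "fib (2 * a + 2) * ?P ds = fib (2 * a + 2) * fib (2 * b + 2)"
          using eq ge mult P by linarith
        then have "?P ds = fib (2 * b + 2)" using pos by (metis mult_cancel1 less_irrefl)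
        from IH(2)[OF this] have ms: "mset ds = mset ((b + 1) # replicate (length ds - 1) 1)" .
        have len_ds: "length ds = Suc (length ds - 1)" using False by (cases ds) auto
        show ?thesis
        proof (cases "a = 0")
          case True
          then show ?thesis using ms by (subst len_ds) (simp add: d)
        next
          case False
          \<comment> \<open>Without excess the tail consists of ones, and the head carries
            everything.\<close>
          then have "b = 0" using calculation by simp
          then show ?thesis using zero[of ds] Cons.prems by (simp add: d b_def)
        qed
      qed
      moreover have "fib (2 * (a + b) + 2) \<le> ?P (d # ds)"
        using ge mult by linarith
      moreover have "2 * (?e (d # ds) + 1) = 2 * (a + b) + 2"
        by (simp only: ab) simp
      ultimately show ?thesis
        by (simp only: ab) simp
    qed
  qed simp
  moreover have "?P ds = fib (2 * (?e ds + 1))"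
    if "mset ds = mset ((?e ds + 1) # replicate (length ds - 1) 1)"
  proof -
    have "?P ds = prod_mset (image_mset (\<lambda>d. fib (2 * d)) (mset ds))"
      by (simp flip: prod_mset_prod_list)
    also have "\<dots> = fib (2 * (?e ds + 1))"
      by (subst that) (simp flip: mset_map)
    finally show ?thesis .
  qed
  ultimately show "fib (2 * (?e ds + 1)) \<le> ?P ds"
    "?P ds = fib (2 * (?e ds + 1)) \<longleftrightarrow>
         mset ds = mset ((?e ds + 1) # replicate (length ds - 1) 1)"
    by blast+
qed

section \<open>Upper bound for the product by concavity\<close>

lemma fib_even_log_concave: "fib (2 * n) * fib (2 * (n + 2)) < fib (2 * (n + 1)) ^ 2"
proof -
  \<comment> \<open>An instance of Catalan's identity: the two sides differ by exactly 1, which is a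
    form suited to induction.\<close>
  have "fib (2 * (n + 1)) ^ 2 = fib (2 * n) * fib (2 * (n + 2)) + 1"
  proof (induction n)
    case (Suc n)
    have "2 * (Suc n + 2) = Suc (Suc (Suc (Suc (2 * Suc n))))" "2 * (Suc n + 1) = Suc (Suc (2 * Suc n))"
      "2 * (n + 1) = 2 * Suc n" "2 * (n + 2) = Suc (Suc (2 * Suc n))"
      "2 * Suc n = Suc (Suc (2 * n))"
      by simp_all
    with Suc show ?case
      by (simp add: power2_eq_square algebra_simps)
  qed simp
  then show ?thesis by simp
qed

text \<open>The line is the secant through \<open>q\<close> and \<open>q + 1\<close>. Increments to
  its right are smaller than its slope and those to its left larger, so the sequence lies strictly
  below it elsewhere. Concavity is asked from 1 on because the sequence in view is the logarithm of
  \<open>fib (2 * n)\<close>, whose argument vanishes at 0.\<close>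

lemma strictly_concave_sequence_tangent:
  fixes h :: "nat \<Rightarrow> real"
  assumes conc: "\<And>n. 0 < n \<Longrightarrow> h (n + 2) - h (n + 1) < h (n + 1) - h n"
    and "0 < q" "0 < d"
  shows "h d \<le> h q + (real d - real q) * (h (q + 1) - h q)"
    and "h d = h q + (real d - real q) * (h (q + 1) - h q) \<longleftrightarrow> d = q \<or> d = q + 1"
proof -
  define s where "s n = h (n + 1) - h n" for n
  have dec: "s (m + k) < s m" if "0 < m" "0 < k" for m k
    using that(2)
  proof (induction k)
    case (Suc k)
    have "s (m + Suc k) < s (m + k)"
      using conc[of "m + k"] \<open>0 < m\<close> by (simp add: s_def)
    then show ?case using Suc by (cases k) auto
  qed simp
  have above: "h (q + 2 + k) < h q + (real k + 2) * s q" for k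
  proof (induction k)
    case 0
    have "h (q + 2) = h q + s q + s (q + 1)" by (simp add: s_def)
    then show ?case using dec[of q 1] \<open>0 < q\<close> by simp
  next
    case (Suc k)
    have "h (q + 2 + Suc k) = h (q + 2 + k) + s (q + (2 + k))" by (simp add: s_def)
    also have "\<dots> < h q + (real k + 2) * s q + s q"
      using Suc dec[of q "2 + k"] \<open>0 < q\<close> by linarith
    finally show ?case by (simp add: algebra_simps)
  qed
  have below: "h m < h q - real k * s q" if "q = m + k" "0 < m" "0 < k" for m k
    using that
  proof (induction k arbitrary: m)
    case (Suc k)
    have s_m: "h (Suc m) = h m + s m" by (simp add: s_def)
    have "s q < s m" using dec[of m "Suc k"] Suc.prems by simp
    moreover have "h (Suc m) \<le> h q - real k * s q"
      using Suc.IH[of "Suc m"] Suc.prems by (cases "k = 0") auto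
    ultimately show ?case using s_m by (simp add: algebra_simps)
  qed simp
  consider "d = q" | "d = q + 1" | k where "d = q + 2 + k" | k where "q = d + k" "0 < k"
    by (metis add_2_eq_Suc' less_imp_add_positive linorder_neqE_nat nat_less_le Suc_eq_plus1
      le_iff_add Suc_leI)
  then have "h d < h q + (real d - real q) * s q \<and> d \<noteq> q \<and> d \<noteq> q + 1 \<or>
     h d = h q + (real d - real q) * s q \<and> (d = q \<or> d = q + 1)"
  proof cases
    case 3
    then show ?thesis using above[of k] by (simp add: algebra_simps)
  next
    case 4
    then show ?thesis using below[of d k] \<open>0 < d\<close> by (simp add: algebra_simps)
  qed (auto simp: s_def)
  then show "h d \<le> h q + (real d - real q) * (h (q + 1) - h q)"
    and "h d = h q + (real d - real q) * (h (q + 1) - h q) \<longleftrightarrow> d = q \<or> d = q + 1"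
    unfolding s_def by auto
qed

lemma sum_list_mono_eq_iff:
  fixes f g :: "'a \<Rightarrow> real"
  assumes "\<And>x. x \<in> set xs \<Longrightarrow> f x \<le> g x"
  shows "(\<Sum>x\<leftarrow>xs. f x) = (\<Sum>x\<leftarrow>xs. g x) \<longleftrightarrow> (\<forall>x \<in> set xs. f x = g x)"
  using assms
proof (induction xs)
  case (Cons x xs)
  have "(\<Sum>x\<leftarrow>xs. f x) \<le> (\<Sum>x\<leftarrow>xs. g x)"
    using Cons.prems by (intro sum_list_mono) simp
  then show ?case using Cons by (auto simp: add_le_imp_le_left) (smt (verit))+
qed simp

text \<open>After taking logarithms each term is bounded by the secant through \<open>q\<close> and
  \<open>q + 1\<close>. The secant values add up to a constant fixed by the number and the sum of
  the entries, so equality of the sums means equality in every term.\<close>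

lemma prod_list_fib_le:
  fixes ds :: "nat list"
  assumes pos: "\<forall>d \<in> set ds. 0 < d" and "0 < q"
    and sum: "sum_list ds = q * length ds + s" and s: "s \<le> length ds"
  shows "(\<Prod>d\<leftarrow>ds. fib (2 * d)) \<le> fib (2 * (q + 1)) ^ s * fib (2 * q) ^ (length ds - s)"
    and "(\<Prod>d\<leftarrow>ds. fib (2 * d)) = fib (2 * (q + 1)) ^ s * fib (2 * q) ^ (length ds - s) \<longleftrightarrow>
         set ds \<subseteq> {q, q + 1}"
proof -
  define h where "h n = ln (real (fib (2 * n)))" for n
  have fib_pos: "0 < real (fib (2 * n))" if "0 < n" for n
    using fib_even_pos[OF that] by simp
  have conc: "h (n + 2) - h (n + 1) < h (n + 1) - h n" if "0 < n" for n
  proof -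
    have "real (fib (2 * n) * fib (2 * (n + 2))) < real (fib (2 * (n + 1)) ^ 2)"
      using fib_even_log_concave by (subst of_nat_less_iff)
    then have "ln (real (fib (2 * n)) * real (fib (2 * (n + 2)))) < ln (real (fib (2 * (n + 1))) ^ 2)"
      using fib_pos[of n] fib_pos[of "n + 1"] fib_pos[of "n + 2"] that
      by (subst ln_less_cancel_iff) (auto simp del: fib.simps mult_Suc_right)
    then have "h n + h (n + 2) < 2 * h (n + 1)"
      using fib_pos[of n] fib_pos[of "n + 1"] fib_pos[of "n + 2"] that
      by (simp add: h_def ln_mult ln_realpow del: fib.simps mult_Suc_right)
    then show ?thesis by simp
  qed
  define t where "t d = h q + (real d - real q) * (h (q + 1) - h q)" for d
  have h_le: "h d \<le> t d" and h_eq: "h d = t d \<longleftrightarrow> d = q \<or> d = q + 1" if "0 < d" for d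
    using strictly_concave_sequence_tangent[of h, OF conc \<open>0 < q\<close> that] by (auto simp: t_def)
  have sum_affine: "(\<Sum>d\<leftarrow>xs. t d) =
      real (length xs) * h q + (real (sum_list xs) - real q * real (length xs)) * (h (q + 1) - h q)"
    for xs
    by (induction xs) (auto simp: t_def algebra_simps)
  \<comment> \<open>The given sum leaves the coefficient \<open>s\<close> on the slope, as for
    \<open>s\<close> entries \<open>q + 1\<close> and \<open>length ds - s\<close> entries
    \<open>q\<close>.\<close>
  then have sum_t: "(\<Sum>d\<leftarrow>ds. t d) = real s * h (q + 1) + real (length ds - s) * h q"
    unfolding sum_affine using s by (simp add: sum of_nat_diff algebra_simps)
  have prod_pos: "0 < (\<Prod>d\<leftarrow>xs. fib (2 * d))" if "\<forall>d \<in> set xs. 0 < d" for xs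
    using that by (induction xs) (auto simp: fib_neq_0_nat)
  have ln_prod: "ln (real (\<Prod>d\<leftarrow>xs. fib (2 * d))) = (\<Sum>d\<leftarrow>xs. h d)" if "\<forall>d \<in> set xs. 0 < d" for xs
    using that
  proof (induction xs)
    case (Cons x xs)
    then show ?case
      using prod_pos[of xs] fib_pos[of x] by (simp add: h_def ln_mult)
  qed simp
  let ?M = "fib (2 * (q + 1)) ^ s * fib (2 * q) ^ (length ds - s)"
  have M_pos: "0 < ?M"
    using fib_even_pos[of q] fib_even_pos[of "q + 1"] \<open>0 < q\<close> by simp
  have ln_M: "ln (real ?M) = (\<Sum>d\<leftarrow>ds. t d)"
    using fib_pos[of q] fib_pos[of "q + 1"] \<open>0 < q\<close>
    by (simp add: sum_t h_def ln_mult ln_realpow del: fib.simps mult_Suc_right)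
  have cmp: "a \<le> b \<longleftrightarrow> ln (real a) \<le> ln (real b)" "a = b \<longleftrightarrow> ln (real a) = ln (real b)"
    if "0 < a" "0 < b" for a b :: nat
    using that by auto
  show "(\<Prod>d\<leftarrow>ds. fib (2 * d)) \<le> ?M"
    unfolding cmp(1)[OF prod_pos[OF pos] M_pos] ln_M ln_prod[OF pos]
    using h_le pos by (intro sum_list_mono) auto
  show "(\<Prod>d\<leftarrow>ds. fib (2 * d)) = ?M \<longleftrightarrow> set ds \<subseteq> {q, q + 1}"
    unfolding cmp(2)[OF prod_pos[OF pos] M_pos] ln_M ln_prod[OF pos]
    using h_le h_eq pos by (subst sum_list_mono_eq_iff) auto
qed

text \<open>Forwards, the sum forces the number of entries \<open>q + 1\<close>; backwards, the two
  counts exhaust the length, so no other value can occur.\<close>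

lemma subset_consecutive_iff_count_list:
  fixes ds :: "nat list"
  assumes sum: "sum_list ds = q * length ds + s" and s: "s \<le> length ds"
  shows "set ds \<subseteq> {q, q + 1} \<longleftrightarrow> count_list ds (q + 1) = s \<and> count_list ds q = length ds - s"
proof -
  have le: "count_list xs q + count_list xs (q + 1) \<le> length xs" for xs :: "nat list"
    by (induction xs) auto
  have eq: "count_list xs q + count_list xs (q + 1) = length xs \<longleftrightarrow> set xs \<subseteq> {q, q + 1}" for xs
  proof (induction xs)
    case (Cons x xs)
    then show ?case using le[of xs] by auto
  qed simp
  have "sum_list xs = q * length xs + count_list xs (q + 1)" if "set xs \<subseteq> {q, q + 1}" for xs
    using that by (induction xs) auto
  then show ?thesis
    using eq[of ds] sum s by auto
qed

section \<open>Attained bounds and extremal sets\<close>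

lemma is_arg_max_iff_eq_max:
  fixes f :: "'a \<Rightarrow> 'b::linorder"
  assumes "\<And>y. P y \<Longrightarrow> f y \<le> M" and "P z" and "f z = M" and "P x"
  shows "is_arg_max f P x \<longleftrightarrow> f x = M"
  using assms by (auto simp: is_arg_max_def not_less intro: antisym)

lemma is_arg_min_iff_eq_min:
  fixes f :: "'a \<Rightarrow> 'b::linorder"
  assumes "\<And>y. P y \<Longrightarrow> m \<le> f y" and "P z" and "f z = m" and "P x"
  shows "is_arg_min f P x \<longleftrightarrow> f x = m"
  using assms by (auto simp: is_arg_min_def not_less intro: antisym)

theorem theorem5p1:
  fixes N r q s :: nat
  assumes "3 \<le> N" and "1 \<le> r" and "r \<le> N"
    and "N = q * r + s" and "s < r"
  shows
    "(\<forall>R \<in> rim_subsets N r.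
        is_arg_max (\<lambda>R'. num_rooted_spanning_forests (wheel N) ({Center} \<union> R'))
          (\<lambda>R'. R' \<in> rim_subsets N r) R \<longleftrightarrow>
        count_list (cyclic_intervals N R) (q + 1) = s \<and>
        count_list (cyclic_intervals N R) q = r - s) \<and>
     Max ((\<lambda>R. num_rooted_spanning_forests (wheel N) ({Center} \<union> R)) ` rim_subsets N r) =
       fib (2 * (q + 1)) ^ s * fib (2 * q) ^ (r - s) \<and>
     (\<forall>R \<in> rim_subsets N r.
        is_arg_min (\<lambda>R'. num_rooted_spanning_forests (wheel N) ({Center} \<union> R'))
          (\<lambda>R'. R' \<in> rim_subsets N r) R \<longleftrightarrow>
        mset (cyclic_intervals N R) = mset ((N - r + 1) # replicate (r - 1) 1)) \<and>
     Min ((\<lambda>R. num_rooted_spanning_forests (wheel N) ({Center} \<union> R)) ` rim_subsets N r) =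
       fib (2 * (N - r + 1))"
proof -
  let ?f = "\<lambda>R. num_rooted_spanning_forests (wheel N) ({Center} \<union> R)"
  let ?P = "\<lambda>ds. \<Prod>d\<leftarrow>ds. fib (2 * d)"
  let ?M = "fib (2 * (q + 1)) ^ s * fib (2 * q) ^ (r - s)"
  let ?m = "fib (2 * (N - r + 1))"
  \<comment> \<open>\<open>q = 0\<close> would give \<open>N = s < r\<close>, against
    \<open>r \<le> N\<close>.\<close>
  have q: "0 < q"
    using assms by (cases q) auto
  have ci: "?f R = ?P (cyclic_intervals N R)" "length (cyclic_intervals N R) = r"
      "\<forall>d \<in> set (cyclic_intervals N R). 0 < d" "sum_list (cyclic_intervals N R) = N"
      "cyclic_intervals N R \<noteq> []"
    if "R \<in> rim_subsets N r" for R
  proof -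
    have R: "R \<subseteq> rim N" "R \<noteq> {}" "card R = r"
      using that assms by (auto simp: rim_subsets_def)
    show "?f R = ?P (cyclic_intervals N R)"
      using num_rooted_spanning_forests_wheel[OF \<open>3 \<le> N\<close> R(1,2)] .
    show len: "length (cyclic_intervals N R) = r" and "\<forall>d \<in> set (cyclic_intervals N R). 0 < d"
      and "sum_list (cyclic_intervals N R) = N"
      using cyclic_intervals_composition[OF R(1,2)] R(3) by auto
    show "cyclic_intervals N R \<noteq> []"
      using len assms by auto
  qed
  have realise: "\<exists>R \<in> rim_subsets N r. cyclic_intervals N R = ds"
    if "length ds = r" "\<forall>d \<in> set ds. 0 < d" "sum_list ds = N" for ds
    using composition_is_cyclic_intervals[of ds N] that assms by (fastforce simp: rim_subsets_def)
  have fin: "finite (?f ` rim_subsets N r)"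
    by (auto simp: rim_subsets_def rim_def intro: finite_subset[of _ "Pow (rim N)"])
  have max_le: "?f R \<le> ?M" and max_eq: "?f R = ?M \<longleftrightarrow>
      count_list (cyclic_intervals N R) (q + 1) = s \<and> count_list (cyclic_intervals N R) q = r - s"
    if R: "R \<in> rim_subsets N r" for R
  proof -
    have sum: "sum_list (cyclic_intervals N R) = q * length (cyclic_intervals N R) + s"
      and le: "s \<le> length (cyclic_intervals N R)"
      using ci[OF R] assms by auto
    show "?f R \<le> ?M"
      using prod_list_fib_le(1)[OF ci(3)[OF R] q sum le] ci(1,2)[OF R] by simp
    show "?f R = ?M \<longleftrightarrow>
        count_list (cyclic_intervals N R) (q + 1) = s \<and> count_list (cyclic_intervals N R) q = r - s"
      using prod_list_fib_le(2)[OF ci(3)[OF R] q sum le] subset_consecutive_iff_count_list[OF sum le]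
        ci(1,2)[OF R] by simp
  qed
  \<comment> \<open>Witness for the maximum: its sum is
    \<open>s * (q + 1) + (r - s) * q = q * r + s = N\<close>, and its entries are positive as
    \<open>0 < q\<close>.\<close>
  have "\<exists>R \<in> rim_subsets N r. cyclic_intervals N R = replicate s (q + 1) @ replicate (r - s) q"
    using assms q by (intro realise) (auto simp: sum_list_replicate algebra_simps diff_mult_distrib2)
  then obtain R1 where R1: "R1 \<in> rim_subsets N r" "?f R1 = ?M"
    using ci(1) by (metis (no_types, lifting) map_append map_replicate prod_list.append prod_list_replicate)
  have min_ge: "?m \<le> ?f R" and min_eq: "?f R = ?m \<longleftrightarrow>
      mset (cyclic_intervals N R) = mset ((N - r + 1) # replicate (r - 1) 1)"
    if R: "R \<in> rim_subsets N r" for R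
    using prod_list_fib_ge[OF ci(5,3)[OF R]] ci(1,2,4)[OF R] by simp_all
  have "\<exists>R \<in> rim_subsets N r. cyclic_intervals N R = (N - r + 1) # replicate (r - 1) 1"
    using assms by (intro realise) (auto simp: sum_list_replicate)
  then obtain R2 where R2: "R2 \<in> rim_subsets N r" "?f R2 = ?m"
    using min_eq by metis
  have "Max (?f ` rim_subsets N r) = ?M"
    using max_le R1(2) image_eqI[of ?M ?f R1, OF _ R1(1)] by (intro Max_eqI[OF fin]) auto
  moreover have "Min (?f ` rim_subsets N r) = ?m"
    using min_ge R2(2) image_eqI[of ?m ?f R2, OF _ R2(1)] by (intro Min_eqI[OF fin]) auto
  moreover have "is_arg_max ?f (\<lambda>R'. R' \<in> rim_subsets N r) R \<longleftrightarrow> ?f R = ?M"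
    if "R \<in> rim_subsets N r" for R
    by (rule is_arg_max_iff_eq_max[where z = R1]) (use max_le R1 that in auto)
  moreover have "is_arg_min ?f (\<lambda>R'. R' \<in> rim_subsets N r) R \<longleftrightarrow> ?f R = ?m"
    if "R \<in> rim_subsets N r" for R
    by (rule is_arg_min_iff_eq_min[where z = R2]) (use min_ge R2 that in auto)
  ultimately show ?thesis
    using max_eq min_eq by simp
qed

end
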